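(* Let $t\ge 1$ be an integer and let $f:\mathbb{N}\to\mathbb{N}$ be a function with $f(1)=f(2)=f(3)=f(4)=f(5)=t$. Let $\mathcal{C}$ be the class of all graphs $H$ with $\mathrm{ltw}^H(r) \le f(r)$ for all $r\in\mathbb{N}$. Let $G$ be a graph on $n$ vertices which is the complement of a $c$-closed graph. Then the number of inclusion-maximal sets $S\subseteq V(G)$ with $G[S]\in\mathcal{C}$ is $O(n^{t+4}4^{c-1})$.
   Context: Graphs are finite, simple and undirected. A graph $H$ is $c$-closed if any two non-adjacent vertices have at most $c-1$ common neighbors; $G$ is the complement of a $c$-closed graph iff for any two adjacent vertices $u,v$ of $G$ at most $c-1$ vertices of $G$ are adjacent to neither $u$ nor $v$ (excluding $u,v$). For a graph $H$, a vertex $v$ and $r\in\mathbb{N}$, $N_r(v)$ is the set of vertices at distance at most $r$ from $v$ in $H$, and the local treewidth is $\mathrm{ltw}^H(r) = \max\{\mathrm{tw}(H[N_r(v)]) : v\in V(H)\}$, where $\mathrm{tw}$ denotes treewidth. *)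

theory Defs
  imports "Graph_Theory.Graph_Theory"
begin

definition complement_graph :: "'a pair_pre_digraph \<Rightarrow> 'a pair_pre_digraph" where
  "complement_graph H = \<lparr> pverts = pverts H,
     parcs = {(u, v). u \<in> pverts H \<and> v \<in> pverts H \<and> u \<noteq> v \<and> (u, v) \<notin> parcs H} \<rparr>"

definition c_closed :: "nat \<Rightarrow> 'a pair_pre_digraph \<Rightarrow> bool" where
  "c_closed c H \<longleftrightarrow> (\<forall>u\<in>pverts H. \<forall>v\<in>pverts H. u \<noteq> v \<and> (u, v) \<notin> parcs H \<longrightarrow>
     card {w \<in> pverts H. (u, w) \<in> parcs H \<and> (v, w) \<in> parcs H} \<le> c - 1)"

text \<open>
  The library's \<^const>\<open>tree\<close> forbids directed cycles. This is not the notion for undirected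
  graphs, which are symmetric digraphs here: going back and forth along an edge is a directed
  cycle of length 2. The cycles of an undirected graph are the directed ones of length at least 3.
\<close>
definition undirected_tree :: "'a pair_pre_digraph \<Rightarrow> bool" where
  "undirected_tree T \<longleftrightarrow> pair_graph T \<and> connected T \<and>
     \<not> (\<exists>p. pre_digraph.cycle T p \<and> length p \<ge> 3)"

definition tree_decomposition ::
  "('a, 'b) pre_digraph \<Rightarrow> 'i pair_pre_digraph \<Rightarrow> ('i \<Rightarrow> 'a set) \<Rightarrow> bool" where
  "tree_decomposition H T B \<longleftrightarrow> undirected_tree T \<and>
     (\<Union>i\<in>pverts T. B i) = verts H \<and>
     (\<forall>u v. u \<rightarrow>\<^bsub>H\<^esub> v \<longrightarrow> (\<exists>i\<in>pverts T. u \<in> B i \<and> v \<in> B i)) \<and>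
     (\<forall>v\<in>verts H. connected (with_proj T \<restriction> {i \<in> pverts T. v \<in> B i}))"

definition decomposition_width :: "'i pair_pre_digraph \<Rightarrow> ('i \<Rightarrow> 'a set) \<Rightarrow> nat" where
  "decomposition_width T B = Max ((\<lambda>i. card (B i)) ` pverts T) - 1"

text \<open>
  Decomposition trees are finite, so it is no restriction to take their nodes in \<^typ>\<open>nat\<close>.
  The graph without vertices gets treewidth 0 (instead of -1).
\<close>
definition treewidth :: "('a, 'b) pre_digraph \<Rightarrow> nat" where
  "treewidth H = (LEAST k. \<exists>(T :: nat pair_pre_digraph) B.
     tree_decomposition H T B \<and> decomposition_width T B = k)"

text \<open>With unit weights, \<^const>\<open>wf_digraph.\<mu>\<close> is the number of edges on a shortest walk.\<close>
definition nbhd :: "('a, 'b) pre_digraph \<Rightarrow> nat \<Rightarrow> 'a \<Rightarrow> 'a set" where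
  "nbhd H r v = {u \<in> verts H. wf_digraph.\<mu> H (\<lambda>_. 1) v u \<le> ereal (real r)}"

text \<open>
  For a finite nonempty set of naturals \<^const>\<open>Sup\<close> is the maximum; for the graph without
  vertices the value is 0.
\<close>
definition local_treewidth :: "('a, 'b) pre_digraph \<Rightarrow> nat \<Rightarrow> nat" where
  "local_treewidth H r = (SUP v\<in>verts H. treewidth (H \<restriction> nbhd H r v))"

definition ltw_class :: "(nat \<Rightarrow> nat) \<Rightarrow> ('a, 'b) pre_digraph set" where
  "ltw_class f = {H. graph H \<and> (\<forall>r. local_treewidth H r \<le> f r)}"

definition maximal_sets_in_class ::
  "'a pair_pre_digraph \<Rightarrow> ('a, 'a \<times> 'a) pre_digraph set \<Rightarrow> 'a set set" where
  "maximal_sets_in_class G \<C> = {S. S \<subseteq> pverts G \<and> with_proj G \<restriction> S \<in> \<C> \<and>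
     (\<forall>S'. S \<subset> S' \<and> S' \<subseteq> pverts G \<longrightarrow> with_proj G \<restriction> S' \<notin> \<C>)}"

end

theory Submission
  imports Defs
begin

text \<open>
  Let \<open>k\<close> be the minimum of \<open>f\<close> over the positive radii; it is attained at a radius \<open>r \<ge> 4\<close>.
  Say that \<open>S\<close> is covered by two edges \<open>uv\<close> and \<open>u'v'\<close> of \<open>G[S]\<close> if, after removal of at most \<open>t\<close>
  vertices, every other vertex of \<open>S\<close> is a common non-neighbour of \<open>u, v\<close> or of \<open>u', v'\<close>.
  An edge has at most \<open>c - 1\<close> common non-neighbours, so only \<open>O(n\<^sup>t n\<^sup>4 4\<^bsup>c-1\<^esup>)\<close> sets are covered.

  If \<open>S\<close> is not covered, then any two edges of \<open>G[S]\<close> are joined through a single vertex, so the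
  ball of radius \<open>r\<close> around a non-isolated vertex contains all edges of \<open>G[S]\<close>; its treewidth is
  at most \<open>k\<close>. If every bag of an optimal tree decomposition missed some edge, let every node point
  towards the edge missed by its bag; two adjacent nodes then point at each other, and the at most
  \<open>k\<close> common vertices of their bags separate the two missed edges, so \<open>S\<close> would be covered. Hence
  some bag \<open>B\<close> meets all edges. By the Helly property of subtrees, no vertex outside \<open>B\<close> has more
  than \<open>k\<close> neighbours in \<open>B\<close>. Conversely, every set of this shape has a star-shaped tree
  decomposition of width at most \<open>k\<close>. So for maximal \<open>S\<close> the set \<open>S - B\<close> is a maximal independent
  set of the graph induced on the vertices with at most \<open>k\<close> neighbours in \<open>B\<close>, and such sets
  number at most \<open>1 + n\<^sup>2 2\<^bsup>c-1\<^esup>\<close>.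
\<close>

section \<open>Subtrees of a finite tree\<close>

text \<open>Connectivity is phrased on relations, so that the tree arguments stay independent of the
  digraph representation. Nonemptiness is demanded because \<open>connected\<close> demands it
  too.\<close>

definition linked :: "'i rel \<Rightarrow> 'i set \<Rightarrow> bool" where
  "linked E F \<longleftrightarrow> F \<noteq> {} \<and> (\<forall>x\<in>F. \<forall>y\<in>F. (x, y) \<in> (E \<inter> F \<times> F)\<^sup>*)"

lemma linked_Un:
  assumes "linked E F" "linked E F'" "F \<inter> F' \<noteq> {}"
  shows "linked E (F \<union> F')"
proof -
  let ?R = "(E \<inter> (F \<union> F') \<times> (F \<union> F'))\<^sup>*"
  have sub: "(E \<inter> F \<times> F)\<^sup>* \<subseteq> ?R" "(E \<inter> F' \<times> F')\<^sup>* \<subseteq> ?R"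
    by (rule rtrancl_mono, blast)+
  obtain z where z: "z \<in> F" "z \<in> F'" using assms(3) by blast
  have "(x, z) \<in> ?R" "(z, x) \<in> ?R" if "x \<in> F \<union> F'" for x
    using that z sub assms(1,2) unfolding linked_def by blast+
  then have "\<forall>x\<in>F \<union> F'. \<forall>y\<in>F \<union> F'. (x, y) \<in> ?R"
    by (meson rtrancl_trans)
  then show ?thesis using assms(1) unfolding linked_def by blast
qed

text \<open>\<open>no_detour\<close> is acyclicity seen from a node \<open>i\<close>: a walk between
  two distinct neighbours of \<open>i\<close> that avoids \<open>i\<close> would close to a
  cycle.\<close>

locale finite_tree =
  fixes N :: "'i set" and E :: "'i rel"
  assumes finite_nodes: "finite N"
    and edges_in_nodes: "E \<subseteq> N \<times> N"
    and edges_sym: "sym E"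
    and no_loop: "(i, i) \<notin> E"
    and nodes_linked: "linked E N"
    and no_detour: "\<lbrakk>(i, j) \<in> E; (i, m) \<in> E; (j, m) \<in> (Restr E (- {i}))\<^sup>*\<rbrakk> \<Longrightarrow> j = m"
begin

text \<open>For an edge from \<open>i\<close> to \<open>j\<close> this is the component containing
  \<open>j\<close> after deletion of \<open>i\<close>.\<close>

definition branch :: "'i \<Rightarrow> 'i \<Rightarrow> 'i set" where
  "branch i j = {p. (j, p) \<in> (Restr E (- {i}))\<^sup>*}"

lemma branch_root: "j \<in> branch i j"
  by (simp add: branch_def)

lemma branch_avoids:
  assumes "(i, j) \<in> E" "p \<in> branch i j"
  shows "p \<noteq> i"
proof -
  have "(j, p) \<in> (Restr E (- {i}))\<^sup>*" using assms(2) by (simp add: branch_def)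
  then show ?thesis using assms(1) no_loop by induct auto
qed

lemma branch_in_nodes:
  assumes "(i, j) \<in> E"
  shows "branch i j \<subseteq> N"
proof
  fix p assume "p \<in> branch i j"
  then have "(j, p) \<in> (Restr E (- {i}))\<^sup>*" by (simp add: branch_def)
  then show "p \<in> N" using assms edges_in_nodes by induct auto
qed

lemma branch_step:
  assumes "(i, j) \<in> E" "p \<in> branch i j" "(p, q) \<in> E" "q \<noteq> i"
  shows "q \<in> branch i j"
proof -
  have "(p, q) \<in> Restr E (- {i})" using assms branch_avoids by auto
  then show ?thesis using assms(2) unfolding branch_def by (auto intro: rtrancl_into_rtrancl)
qed

text \<open>A branch can be left only towards \<open>i\<close>. Then \<open>p\<close> is a neighbour
  of \<open>i\<close> reached from \<open>j\<close> without visiting \<open>i\<close>, so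
  \<open>no_detour\<close> makes it \<open>j\<close>.\<close>

lemma branch_boundary:
  assumes "(i, j) \<in> E" "p \<in> branch i j" "(p, q) \<in> E" "q \<notin> branch i j"
  shows "p = j \<and> q = i"
proof -
  have q: "q = i" using assms branch_step by blast
  then have "(i, p) \<in> E" using assms(3) edges_sym by (auto elim: symE)
  moreover have "(j, p) \<in> (Restr E (- {i}))\<^sup>*" using assms(2) by (simp add: branch_def)
  ultimately have "j = p" using assms(1) by (intro no_detour)
  with q show ?thesis by simp
qed

text \<open>By \<open>branch_boundary\<close> for the reversed step, a walk from \<open>i\<close>
  can enter \<open>branch i j\<close> only at \<open>j\<close>, but the walks defining
  \<open>branch j i\<close> avoid \<open>j\<close>.\<close>

lemma branches_disjoint:
  assumes "(i, j) \<in> E"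
  shows "branch i j \<inter> branch j i = {}"
proof -
  have "p \<notin> branch i j" if "(i, p) \<in> (Restr E (- {j}))\<^sup>*" for p
    using that
  proof induct
    case base
    then show ?case using assms branch_avoids by blast
  next
    case (step y z)
    then have "(z, y) \<in> E" "z \<noteq> j" using edges_sym by (auto elim: symE)
    then show ?case using step(3) assms branch_boundary by blast
  qed
  then show ?thesis unfolding branch_def[of j i] by blast
qed

text \<open>A walk from \<open>m\<close> avoiding \<open>j\<close> cannot leave
  \<open>branch i j\<close>, whose only exit is at \<open>j\<close>. Strictness makes branch size a
  decreasing measure along pointers that never turn back.\<close>

lemma branch_psubset:
  assumes "(i, j) \<in> E" "(j, m) \<in> E" "m \<noteq> i"
  shows "branch j m \<subset> branch i j"
proof -
  have "p \<in> branch i j" if "(m, p) \<in> (Restr E (- {j}))\<^sup>*" for p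
    using that
  proof induct
    case base
    then show ?case using branch_step[OF assms(1) branch_root assms(2,3)] .
  next
    case (step y z)
    then show ?case using assms branch_boundary by blast
  qed
  then have "branch j m \<subseteq> branch i j" unfolding branch_def[of j m] by blast
  moreover have "j \<notin> branch j m" using branch_avoids[OF assms(2)] by blast
  ultimately show ?thesis using branch_root[of j i] by blast
qed

lemma linked_in_branch:
  assumes "linked E F" "F \<subseteq> N" "i \<in> N" "i \<notin> F"
  obtains j where "(i, j) \<in> E" "F \<subseteq> branch i j"
proof -
  obtain x where x: "x \<in> F" using assms(1) by (auto simp: linked_def)
  have "(i, x) \<in> (E \<inter> N \<times> N)\<^sup>*" using nodes_linked x assms by (auto simp: linked_def)
  then have "(i, x) \<in> E\<^sup>*" using rtrancl_mono[of "E \<inter> N \<times> N" E] by blast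
  then have "x = i \<or> (\<exists>j. (i, j) \<in> E \<and> x \<in> branch i j)"
  proof induct
    case (step y z)
    then show ?case using branch_step branch_root by blast
  qed simp
  then obtain j where j: "(i, j) \<in> E" "x \<in> branch i j" using x assms(4) by auto
  have "(E \<inter> F \<times> F)\<^sup>* \<subseteq> (Restr E (- {i}))\<^sup>*" by (rule rtrancl_mono) (use assms(4) in auto)
  then have "(x, y) \<in> (Restr E (- {i}))\<^sup>*" if "y \<in> F" for y
    using x assms(1) that by (auto simp: linked_def)
  then have "F \<subseteq> branch i j"
    using j(2) unfolding branch_def by (auto intro: rtrancl_trans)
  with j(1) show ?thesis by (rule that)
qed

lemma linked_across_edge:
  assumes "linked E F" "(i, j) \<in> E" "x \<in> F" "x \<in> branch i j" "y \<in> F" "y \<notin> branch i j"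
  shows "i \<in> F \<and> j \<in> F"
proof -
  have "(x, y) \<in> (E \<inter> F \<times> F)\<^sup>*" using assms by (auto simp: linked_def)
  then have "y \<in> branch i j \<or> i \<in> F \<and> j \<in> F"
  proof induct
    case (step y z)
    then show ?case using branch_boundary[OF assms(2)] by blast
  qed (use assms(4) in simp)
  with assms(6) show ?thesis by blast
qed

text \<open>Take a node whose pointed branch is smallest. If the next pointer did not turn back, its
  branch would be strictly smaller by \<open>branch_psubset\<close>.\<close>

lemma opposite_pointers:
  assumes g: "\<And>i. i \<in> N \<Longrightarrow> (i, g i) \<in> E"
  obtains i where "i \<in> N" "g (g i) = i"
proof -
  have "N \<noteq> {}" using nodes_linked by (simp add: linked_def)
  then obtain i where i: "i \<in> N" "\<And>m. m \<in> N \<Longrightarrow> card (branch i (g i)) \<le> card (branch m (g m))"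
    using ex_has_least_nat[of "\<lambda>i. i \<in> N" _ "\<lambda>i. card (branch i (g i))"] by blast
  have gi: "g i \<in> N" using g[OF i(1)] edges_in_nodes by blast
  have "g (g i) = i"
  proof (rule ccontr)
    assume "g (g i) \<noteq> i"
    then have "branch (g i) (g (g i)) \<subset> branch i (g i)"
      using branch_psubset g i(1) gi by blast
    moreover have "finite (branch i (g i))"
      using branch_in_nodes[OF g[OF i(1)]] finite_nodes finite_subset by blast
    ultimately have "card (branch (g i) (g (g i))) < card (branch i (g i))"
      by (rule psubset_card_mono[rotated])
    with i(2)[OF gi] show False by simp
  qed
  with i(1) show ?thesis by (rule that)
qed

text \<open>Each node \<open>i\<close> points to the branch that holds \<open>F i\<close>; the edge
  is one whose two ends point at each other.\<close>

lemma edge_separating_missed_subtrees: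
  assumes F: "\<And>i. i \<in> N \<Longrightarrow> linked E (F i) \<and> F i \<subseteq> N \<and> i \<notin> F i"
  obtains i j where "(i, j) \<in> E" "F i \<subseteq> branch i j" "F j \<subseteq> branch j i"
proof -
  have "\<exists>j. (i, j) \<in> E \<and> F i \<subseteq> branch i j" if "i \<in> N" for i
    using linked_in_branch[of "F i" i] F[OF that] that by blast
  then obtain g where g: "\<And>i. i \<in> N \<Longrightarrow> (i, g i) \<in> E \<and> F i \<subseteq> branch i (g i)" by metis
  then obtain i where i: "i \<in> N" "g (g i) = i" using opposite_pointers by metis
  then have "g i \<in> N" using g edges_in_nodes by blast
  then show ?thesis using that[of i "g i"] g[of i] g[of "g i"] i by auto
qed

text \<open>Otherwise every node is missed by some member of the family, and
  \<open>edge_separating_missed_subtrees\<close> places two members in disjoint branches.\<close>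

lemma subtrees_Helly:
  assumes F: "\<And>A. A \<in> \<F> \<Longrightarrow> linked E A \<and> A \<subseteq> N"
    and meet: "\<And>A A'. A \<in> \<F> \<Longrightarrow> A' \<in> \<F> \<Longrightarrow> A \<inter> A' \<noteq> {}"
  shows "\<exists>i\<in>N. \<forall>A\<in>\<F>. i \<in> A"
proof (rule ccontr)
  assume "\<not> ?thesis"
  then have "\<forall>i\<in>N. \<exists>A. A \<in> \<F> \<and> i \<notin> A" by blast
  then obtain A where A: "\<And>i. i \<in> N \<Longrightarrow> A i \<in> \<F> \<and> i \<notin> A i" by metis
  obtain i j where ij: "(i, j) \<in> E" "A i \<subseteq> branch i j" "A j \<subseteq> branch j i"
    using edge_separating_missed_subtrees[of A] A F by metis
  moreover have "i \<in> N" "j \<in> N" using ij(1) edges_in_nodes by auto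
  ultimately show False using branches_disjoint[OF ij(1)] A meet[of "A i" "A j"] by blast
qed

end

section \<open>From undirected trees as digraphs to the locale of finite trees\<close>

lemma arcs_ends_induce [simp]:
  "arcs_ends (with_proj G \<restriction> A) = parcs G \<inter> A \<times> A"
  by (auto simp: arcs_ends_conv)

text \<open>\<open>connected\<close> refers to the symmetric closure, which changes nothing here
  since \<open>T\<close> is symmetric already.\<close>

lemma connected_induce_iff_linked:
  assumes "pair_graph T"
  shows "connected (with_proj T \<restriction> A) \<longleftrightarrow> linked (parcs T) A"
proof -
  interpret T: pair_graph T by fact
  interpret I: wf_digraph "with_proj T \<restriction> A" by (rule T.wellformed_induce_subgraph)
  have "sym (parcs T \<inter> A \<times> A)" using T.arcs_symmetric by (auto intro!: symI)
  then have "symmetric (with_proj T \<restriction> A)" by (simp add: symmetric_def)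
  then have parcs: "parcs (mk_symmetric (with_proj T \<restriction> A)) = parcs T \<inter> A \<times> A"
    by (simp add: I.adj_mk_symmetric_eq)
  have "(x, y) \<in> rtrancl_on A (parcs T \<inter> A \<times> A) \<longleftrightarrow> (x, y) \<in> (parcs T \<inter> A \<times> A)\<^sup>*"
    if "x \<in> A" "y \<in> A" for x y
    using that by (auto intro: rtrancl_consistent_rtrancl_on rtrancl_on_rtranclI)
  then show ?thesis
    by (auto simp: connected_def strongly_connected_def reachable_def parcs linked_def)
qed

lemma induce_pverts:
  assumes "pair_wf_digraph T"
  shows "with_proj T \<restriction> pverts T = with_proj T"
proof -
  interpret pair_wf_digraph T by fact
  show ?thesis by (auto simp: induce_subgraph_def with_proj_def intro: in_arcsD1 in_arcsD2)
qed

lemma finite_tree_of_undirected_tree: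
  assumes "undirected_tree T"
  shows "finite_tree (pverts T) (parcs T)"
proof -
  have T: "pair_graph T" and con: "connected T"
    and nocyc: "\<And>p. pre_digraph.cycle T p \<Longrightarrow> length p < 3"
    using assms by (auto simp: undirected_tree_def not_le)
  interpret T: pair_graph T by fact
  show ?thesis
  proof
    show "finite (pverts T)" by (rule T.pair_finite_verts)
    show "parcs T \<subseteq> pverts T \<times> pverts T" by (auto dest: T.in_arcsD1 T.in_arcsD2)
    show "sym (parcs T)" by (auto intro: symI T.arcs_symmetric)
    show "(i, i) \<notin> parcs T" for i using T.no_loops' by blast
    show "linked (parcs T) (pverts T)"
      using con connected_induce_iff_linked[OF T, of "pverts T"]
        induce_pverts[OF T.pair_wf_digraph] by simp
  next
    fix i j m
    assume ij: "(i, j) \<in> parcs T" and im: "(i, m) \<in> parcs T"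
      and jm: "(j, m) \<in> (Restr (parcs T) (- {i}))\<^sup>*"
    show "j = m"
    proof (rule ccontr)
      assume "j \<noteq> m"
      \<comment> \<open>The detour lives in the tree without \<open>i\<close>; there it is shortened
        to a simple path, which the two edges at \<open>i\<close> then close to a cycle.\<close>
      let ?D = "with_proj T \<restriction> (pverts T - {i})"
      interpret D: wf_digraph ?D by (rule T.wellformed_induce_subgraph)
      have j: "j \<in> pverts T - {i}" using ij T.no_loops' T.in_arcsD2 by blast
      from jm have "j \<rightarrow>\<^sup>*\<^bsub>?D\<^esub> m"
      proof induct
        case base
        then show ?case using j by (simp add: D.reachable_refl)
      next
        case (step y z)
        then have "y \<rightarrow>\<^bsub>?D\<^esub> z" by (auto dest: T.in_arcsD1 T.in_arcsD2)
        with step(3) show ?case by (rule D.reachable_adj_trans)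
      qed
      then obtain q where "D.awalk j q m" by (auto simp: D.reachable_awalk)
      then obtain p where p: "D.apath j p m" using D.apath_awalk_to_apath by blast
      have sub: "subgraph ?D T" using T.induced_induce[of "pverts T - {i}"] by auto
      have pT: "T.apath j p m" using T.subgraph_apath_imp_apath[OF p sub] .
      have "D.awalk_verts j p = pawalk_verts j p"
        using compatible_awalk_verts[OF compatible_induce_subgraph[of T "pverts T - {i}"]] by simp
      moreover have "set (D.awalk_verts j p) \<subseteq> verts ?D"
        using p D.awalk_verts_in_verts unfolding D.apath_def D.awalk_def by blast
      ultimately have i: "i \<notin> set (pawalk_verts j p)" by auto
      have mi: "(m, i) \<in> parcs T" using im by (rule T.arcs_symmetric)
      have aw: "T.awalk j p m" and d: "distinct (pawalk_verts j p)"
        using pT by (auto simp: T.apath_def)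
      have "p \<noteq> []" using aw \<open>j \<noteq> m\<close> by (auto simp: T.awalk_Nil_iff)
      have walk: "T.awalk j (p @ [(m, i)]) i"
        using aw mi by (auto simp: T.awalk_simps dest: T.in_arcsD2)
      have "pawalk_verts j (p @ [(m, i)]) = pawalk_verts j p @ [i]"
        using T.awalk_verts_append[OF walk] aw by simp
      then have "T.cycle ((i, j) # p @ [(m, i)])"
        using walk ij i d unfolding T.cycle_def
        by (intro exI[of _ i]) (auto simp: T.awalk_Cons_iff)
      \<comment> \<open>The path \<open>p\<close> is nonempty, so the cycle has length at least 3
        and is forbidden.\<close>
      then show False using nocyc \<open>p \<noteq> []\<close> by (cases p) force+
    qed
  qed
qed

section \<open>Treewidth bounds from star-shaped decompositions\<close>

definition star :: "nat \<Rightarrow> nat pair_pre_digraph" where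
  "star m = \<lparr>pverts = {..m}, parcs = {0} \<times> {1..m} \<union> {1..m} \<times> {0}\<rparr>"

lemma star_simps [simp]:
  "pverts (star m) = {..m}"
  "parcs (star m) = {0} \<times> {1..m} \<union> {1..m} \<times> {0}"
  by (simp_all add: star_def)

lemma pair_graph_star: "pair_graph (star m)"
  by unfold_locales (auto simp: symmetric_def intro!: symI)

lemma linked_star:
  assumes "D \<subseteq> {..m}" "0 \<in> D"
  shows "linked (parcs (star m)) D"
proof -
  let ?R = "parcs (star m) \<inter> D \<times> D"
  have "(x, 0) \<in> ?R\<^sup>* \<and> (0, x) \<in> ?R\<^sup>*" if "x \<in> D" for x
  proof (cases "x = 0")
    case False
    then have "(x, 0) \<in> ?R" "(0, x) \<in> ?R" using that assms by auto
    then show ?thesis by blast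
  qed simp
  then show ?thesis using assms(2) unfolding linked_def by (meson empty_iff rtrancl_trans)
qed

text \<open>Walks in a star alternate between centre and leaves, so a closed walk of length at least
  3 has length at least 4 and repeats the centre.\<close>

lemma undirected_tree_star: "undirected_tree (star m)"
proof -
  interpret pair_graph "star m" by (rule pair_graph_star)
  have "\<not> (cycle p \<and> length p \<ge> 3)" for p
  proof
    assume p: "cycle p \<and> length p \<ge> 3"
    then obtain u where u: "awalk u p u" "distinct (tl (pawalk_verts u p))"
      unfolding cycle_def by auto
    obtain a b c q where q: "p = a # b # c # q"
      using p by (auto simp: numeral_3_eq_3 Suc_le_length_iff)
    have "awlast u p = u" using u(1) by auto
    then have "u \<in> set (pawalk_verts (snd c) q)"
      unfolding q by (cases q) (auto split: if_splits)
    then show False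
      using u unfolding q by (cases q) (auto simp: awalk_Cons_iff)
  qed
  moreover have "connected (star m)"
    using connected_induce_iff_linked[OF pair_graph_star, of m "{..m}"] linked_star[of "{..m}" m]
      induce_pverts[of "star m"] pair_wf_digraph by simp
  ultimately show ?thesis unfolding undirected_tree_def using pair_graph_star by auto
qed

lemma treewidth_le:
  assumes "tree_decomposition H (T :: nat pair_pre_digraph) B"
    and "\<And>i. i \<in> pverts T \<Longrightarrow> card (B i) \<le> k + 1"
  shows "treewidth H \<le> k"
proof -
  interpret T: finite_tree "pverts T" "parcs T"
    using assms(1) by (auto simp: tree_decomposition_def intro: finite_tree_of_undirected_tree)
  have "pverts T \<noteq> {}" using T.nodes_linked by (simp add: linked_def)
  then have "decomposition_width T B \<le> k"
    using assms(2) T.finite_nodes by (simp add: decomposition_width_def le_diff_conv)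
  moreover have "treewidth H \<le> decomposition_width T B"
    unfolding treewidth_def by (rule Least_le) (use assms(1) in blast)
  ultimately show ?thesis by simp
qed

text \<open>A single bag suffices; this ensures that the \<open>LEAST\<close> in
  \<open>treewidth\<close> ranges over a nonempty set.\<close>

lemma tree_decomposition_trivial:
  assumes "wf_digraph H"
  shows "tree_decomposition H (star 0) (\<lambda>_. verts H)"
proof -
  have "connected (with_proj (star 0) \<restriction> {0})"
    using connected_induce_iff_linked[OF pair_graph_star, of 0 "{0}"] linked_star[of "{0}" 0] by simp
  moreover have "{i. i = 0 \<and> v \<in> verts H} = {0 :: nat}" if "v \<in> verts H" for v using that by auto
  ultimately show ?thesis
    using wf_digraph.adj_in_verts[OF assms] undirected_tree_star[of 0]
    by (auto simp: tree_decomposition_def)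
qed

lemma treewidth_attained:
  assumes "wf_digraph H"
  obtains T :: "nat pair_pre_digraph" and B
  where "tree_decomposition H T B" "\<And>i. i \<in> pverts T \<Longrightarrow> card (B i) \<le> treewidth H + 1"
proof -
  have "\<exists>k (T :: nat pair_pre_digraph) B. tree_decomposition H T B \<and> decomposition_width T B = k"
    using tree_decomposition_trivial[OF assms] by blast
  then have "\<exists>(T :: nat pair_pre_digraph) B.
      tree_decomposition H T B \<and> decomposition_width T B = treewidth H"
    unfolding treewidth_def by (rule LeastI_ex)
  then obtain T :: "nat pair_pre_digraph" and B where
    TB: "tree_decomposition H T B" "decomposition_width T B = treewidth H" by blast
  have "finite (pverts T)"
    using TB(1) by (auto simp: tree_decomposition_def undirected_tree_def
        intro: pair_fin_digraph.pair_finite_verts pair_digraph.axioms pair_graph.axioms)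
  then have "card (B i) \<le> treewidth H + 1" if "i \<in> pverts T" for i
  proof -
    have "card (B i) \<le> (MAX i\<in>pverts T. card (B i))" using \<open>finite (pverts T)\<close> that by simp
    \<comment> \<open>The subtraction in the width is truncated, but a maximum of 0 also satisfies
      the bound.\<close>
    then show ?thesis using TB(2) unfolding decomposition_width_def by linarith
  qed
  with TB(1) show ?thesis by (rule that)
qed

text \<open>The centre of a star carries the bag \<open>A \<inter> B\<close>; each vertex of
  \<open>A - B\<close> gets a leaf whose bag is the vertex and its neighbours in that set.
  Intersecting with \<open>A\<close> lets one \<open>B\<close> serve for every ball
  \<open>A\<close>.\<close>

lemma treewidth_induce_le:
  assumes G: "pair_graph G" and fin: "finite A" "finite B"
    and indep: "\<And>x y. x \<in> A - B \<Longrightarrow> y \<in> A - B \<Longrightarrow> (x, y) \<notin> parcs G"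
    and cardB: "card B \<le> k + 1"
    and deg: "\<And>v. v \<in> A - B \<Longrightarrow> card {b \<in> B. (v, b) \<in> parcs G} \<le> k"
  shows "treewidth (with_proj G \<restriction> A) \<le> k"
proof -
  interpret G: pair_graph G by fact
  define m where "m = card (A - B)"
  obtain h where h: "bij_betw h {1..m} (A - B)"
    using fin ex_bij_betw_nat_finite_1[of "A - B"] unfolding m_def by blast
  define bag where "bag i = (if i = 0 then A \<inter> B
    else insert (h i) {b \<in> A \<inter> B. (h i, b) \<in> parcs G})" for i
  have hA: "h i \<in> A - B" if "i \<in> {1..m}" for i using h that by (auto simp: bij_betw_def)
  have ex: "\<exists>i\<in>{1..m}. v = h i" if "v \<in> A - B" for v using h that by (auto simp: bij_betw_def)
  have "tree_decomposition (with_proj G \<restriction> A) (star m) bag"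
    unfolding tree_decomposition_def
  proof (intro conjI allI impI ballI)
    show "undirected_tree (star m)" by (rule undirected_tree_star)
    show "(\<Union>i\<in>pverts (star m). bag i) = verts (with_proj G \<restriction> A)"
    proof
      show "(\<Union>i\<in>pverts (star m). bag i) \<subseteq> verts (with_proj G \<restriction> A)"
        using hA by (fastforce simp: bag_def split: if_splits)
      show "verts (with_proj G \<restriction> A) \<subseteq> (\<Union>i\<in>pverts (star m). bag i)"
      proof
        fix v assume "v \<in> verts (with_proj G \<restriction> A)"
        then have v: "v \<in> A" by simp
        show "v \<in> (\<Union>i\<in>pverts (star m). bag i)"
        proof (cases "v \<in> B")
          case True
          then show ?thesis using v by (auto simp: bag_def)
        next
          case False
          then obtain i where "i \<in> {1..m}" "v = h i" using ex v by blast
          then show ?thesis by (auto simp: bag_def intro!: bexI[of _ i])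
        qed
      qed
    qed
  next
    fix u v assume "u \<rightarrow>\<^bsub>with_proj G \<restriction> A\<^esub> v"
    then have uv: "(u, v) \<in> parcs G" "(v, u) \<in> parcs G" "u \<in> A" "v \<in> A"
      using G.arcs_symmetric by auto
    consider "u \<in> B" "v \<in> B" | "u \<in> A - B" "v \<in> B" | "v \<in> A - B" "u \<in> B"
      using indep uv by blast
    then show "\<exists>i\<in>pverts (star m). u \<in> bag i \<and> v \<in> bag i"
    proof cases
      case 1
      then show ?thesis using uv by (auto simp: bag_def intro!: bexI[of _ 0])
    next
      case 2
      then obtain i where "i \<in> {1..m}" "u = h i" using ex by blast
      then show ?thesis using uv 2 by (auto simp: bag_def intro!: bexI[of _ i])
    next
      case 3
      then obtain i where "i \<in> {1..m}" "v = h i" using ex by blast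
      then show ?thesis using uv 3 by (auto simp: bag_def intro!: bexI[of _ i])
    qed
  next
    fix v assume "v \<in> verts (with_proj G \<restriction> A)"
    then have v: "v \<in> A" by simp
    let ?D = "{i \<in> pverts (star m). v \<in> bag i}"
    have "linked (parcs (star m)) ?D"
    proof (cases "v \<in> B")
      case True
      then show ?thesis using v by (intro linked_star) (auto simp: bag_def)
    next
      case False
      then obtain i where i: "i \<in> {1..m}" "v = h i" using ex v by blast
      have "?D = {i}"
      proof -
        have "j = i" if "j \<in> ?D" for j
        proof -
          have "j \<noteq> 0" "v = h j" using that False by (auto simp: bag_def split: if_splits)
          moreover have "inj_on h {1..m}" using h by (rule bij_betw_imp_inj_on)
          moreover have "j \<in> {1..m}" using that \<open>j \<noteq> 0\<close> by auto
          ultimately show ?thesis using i by (metis inj_onD)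
        qed
        moreover have "i \<in> ?D" using i by (auto simp: bag_def)
        ultimately show ?thesis by blast
      qed
      then show ?thesis by (simp add: linked_def)
    qed
    then show "connected (with_proj (star m) \<restriction> ?D)"
      using connected_induce_iff_linked[OF pair_graph_star] by blast
  qed
  moreover have "card (bag i) \<le> k + 1" if "i \<in> pverts (star m)" for i
  proof (cases "i = 0")
    case True
    have "card (A \<inter> B) \<le> card B" using fin by (intro card_mono) auto
    then show ?thesis using True cardB by (simp add: bag_def)
  next
    case False
    have "card {b \<in> A \<inter> B. (h i, b) \<in> parcs G} \<le> card {b \<in> B. (h i, b) \<in> parcs G}"
      using fin by (intro card_mono) auto
    also have "\<dots> \<le> k" using deg hA[of i] that False by auto
    finally have "card {b \<in> A \<inter> B. (h i, b) \<in> parcs G} \<le> k" .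
    moreover have "card (bag i) \<le> Suc (card {b \<in> A \<inter> B. (h i, b) \<in> parcs G})"
      using False by (simp add: bag_def card_insert_le_m1)
    ultimately show ?thesis by simp
  qed
  ultimately show ?thesis by (rule treewidth_le)
qed

section \<open>Balls and membership in the class\<close>

lemma (in wf_digraph) awalk_cost_unit: "awalk_cost (\<lambda>_. 1) p = real (length p)"
  by (induct p) simp_all

lemma in_nbhdI:
  assumes "wf_digraph H" "pre_digraph.awalk H v p u" "length p \<le> r"
  shows "u \<in> nbhd H r v"
proof -
  interpret wf_digraph H by fact
  have "\<mu> (\<lambda>_. 1) v u \<le> ereal (real (length p))"
    using min_cost_le_walk_cost[OF assms(2), of "\<lambda>_. 1"] by (simp add: awalk_cost_unit)
  also have "\<dots> \<le> ereal (real r)" using assms(3) by simp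
  finally show ?thesis using assms(2) by (auto simp: nbhd_def)
qed

text \<open>The distance is an infimum of walk lengths, so a distance below 1 yields a walk of
  length 0.\<close>

lemma nbhd_0:
  assumes "wf_digraph H"
  shows "nbhd H 0 v \<subseteq> {v}"
proof
  interpret wf_digraph H by fact
  fix u assume "u \<in> nbhd H 0 v"
  then have "\<mu> (\<lambda>_. 1) v u < ereal 1" by (auto simp: nbhd_def intro: le_less_trans)
  then obtain p where "awalk v p u" "real (length p) < 1"
    unfolding \<mu>_def INF_less_iff by (auto simp: awalk_cost_unit)
  then show "u \<in> {v}" by (auto simp: awalk_Nil_iff)
qed

lemma induce_induce:
  assumes "A \<subseteq> S"
  shows "(H \<restriction> S) \<restriction> A = H \<restriction> A"
  using assms by (auto simp: induce_subgraph_def)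

lemma graph_induce:
  assumes "pair_graph G" "S \<subseteq> pverts G"
  shows "graph (with_proj G \<restriction> S)"
proof -
  interpret G: pair_graph G by fact
  show ?thesis
    using assms(2) G.pair_finite_verts G.pair_finite_arcs G.no_loops' G.arcs_symmetric
    by unfold_locales (auto simp: arc_to_ends_def symmetric_def intro: finite_subset intro!: symI)
qed

lemma treewidth_ball_le:
  assumes "H \<in> ltw_class f" "v \<in> verts H"
  shows "treewidth (H \<restriction> nbhd H r v) \<le> f r"
proof -
  interpret graph H using assms(1) by (simp add: ltw_class_def)
  have "treewidth (H \<restriction> nbhd H r v) \<le> local_treewidth H r"
    unfolding local_treewidth_def by (rule cSUP_upper) (use assms(2) in auto)
  also have "\<dots> \<le> f r" using assms(1) by (simp add: ltw_class_def)
  finally show ?thesis .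
qed

text \<open>Every ball inherits the shape with the same \<open>B\<close>, so the star decomposition
  bounds its treewidth by \<open>k\<close>.\<close>

lemma induce_in_ltw_class:
  assumes G: "pair_graph G" and S: "S \<subseteq> pverts G" and fin: "finite B"
    and indep: "\<And>x y. x \<in> S - B \<Longrightarrow> y \<in> S - B \<Longrightarrow> (x, y) \<notin> parcs G"
    and cardB: "card B \<le> k + 1"
    and deg: "\<And>v. v \<in> S - B \<Longrightarrow> card {b \<in> B. (v, b) \<in> parcs G} \<le> k"
    and f: "\<And>r. r \<ge> 1 \<Longrightarrow> k \<le> f r"
  shows "with_proj G \<restriction> S \<in> ltw_class f"
proof -
  interpret G: pair_graph G by fact
  let ?H = "with_proj G \<restriction> S"
  interpret H: graph ?H using G S by (rule graph_induce)
  have finS: "finite S" using S G.pair_finite_verts finite_subset by blast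
  have "treewidth ((?H) \<restriction> nbhd ?H r v) \<le> f r" if "v \<in> S" for r v
  proof -
    have sub: "nbhd ?H r v \<subseteq> S" by (auto simp: nbhd_def)
    have finN: "finite (nbhd ?H r v)" using sub finS finite_subset by blast
    have "treewidth (with_proj G \<restriction> nbhd ?H r v) \<le> f r"
    proof (cases "r = 0")
      \<comment> \<open>The value \<open>f 0\<close> may be smaller than \<open>k\<close>, but a
        ball of radius 0 has at most one vertex and hence treewidth 0.\<close>
      case True
      have "nbhd ?H 0 v \<subseteq> {v}" by (rule nbhd_0) unfold_locales
      then have "treewidth (with_proj G \<restriction> nbhd ?H r v) \<le> 0"
        using finN True G.no_loops' by (intro treewidth_induce_le[OF G, of _ "{}"]) auto
      then show ?thesis by simp
    next
      case False
      have "treewidth (with_proj G \<restriction> nbhd ?H r v) \<le> k"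
        using indep deg sub by (intro treewidth_induce_le[OF G finN fin _ cardB]) blast+
      then show ?thesis using f[of r] False by simp
    qed
    then show ?thesis by (simp add: induce_induce[OF sub])
  qed
  \<comment> \<open>For empty \<open>S\<close> the supremum is 0 by convention.\<close>
  then have "local_treewidth ?H r \<le> f r" for r
    unfolding local_treewidth_def by (cases "S = {}") (auto intro: cSUP_least)
  then show ?thesis using H.graph_axioms by (simp add: ltw_class_def)
qed

section \<open>Structure of the induced subgraphs in the class\<close>

definition common_nonneighbours :: "'a pair_pre_digraph \<Rightarrow> 'a \<Rightarrow> 'a \<Rightarrow> 'a set" where
  "common_nonneighbours G u v =
     {w \<in> pverts G - {u, v}. (u, w) \<notin> parcs G \<and> (v, w) \<notin> parcs G}"

text \<open>The two edges may share ends or coincide. All four ends are removed because an end of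
  one edge can be adjacent to the other edge, while \<open>common_nonneighbours\<close> excludes the
  ends of its own edge.\<close>

definition two_edge_covered :: "'a pair_pre_digraph \<Rightarrow> nat \<Rightarrow> 'a set \<Rightarrow> bool" where
  "two_edge_covered G t S \<longleftrightarrow> (\<exists>X u v u' v'. X \<subseteq> S \<and> card X \<le> t \<and>
     (u, v) \<in> parcs G \<and> (u', v') \<in> parcs G \<and> {u, v, u', v'} \<subseteq> S \<and>
     S - X - {u, v, u', v'} \<subseteq> common_nonneighbours G u v \<union> common_nonneighbours G u' v')"

text \<open>\<open>B\<close> plays the role of a bag meeting all edges. The conditions are those
  under which \<open>induce_in_ltw_class\<close> applies.\<close>

definition independent_beyond :: "'a pair_pre_digraph \<Rightarrow> nat \<Rightarrow> 'a set \<Rightarrow> 'a set \<Rightarrow> bool" where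
  "independent_beyond G k B S \<longleftrightarrow> B \<subseteq> S \<and> card B \<le> k + 1 \<and>
     (\<forall>x\<in>S - B. \<forall>y\<in>S - B. (x, y) \<notin> parcs G) \<and>
     (\<forall>v\<in>S - B. card {b \<in> B. (v, b) \<in> parcs G} \<le> k)"

text \<open>In the first outcome \<open>X\<close> is the intersection of the bags of two adjacent
  nodes; in the second, \<open>B\<close> is a bag that meets every edge.\<close>

lemma bounded_bags_dichotomy:
  assumes G: "pair_graph G" and A: "A \<subseteq> pverts G"
    and dec: "tree_decomposition (with_proj G \<restriction> A) T bag"
    and width: "\<And>i. i \<in> pverts T \<Longrightarrow> card (bag i) \<le> k + 1"
  shows "(\<exists>X x y x' y'. X \<subseteq> A \<and> card X \<le> k \<and> (x, y) \<in> parcs G \<and> (x', y') \<in> parcs G \<and>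
        {x, y, x', y'} \<subseteq> A \<and>
        (\<forall>w\<in>A - X. (x, w) \<notin> parcs G \<and> (y, w) \<notin> parcs G \<or>
          (x', w) \<notin> parcs G \<and> (y', w) \<notin> parcs G))
    \<or> (\<exists>B. independent_beyond G k B A)"
proof -
  interpret G: pair_graph G by fact
  have T: "undirected_tree T" and bags: "(\<Union>i\<in>pverts T. bag i) = A"
    and edge_bag: "\<And>u v. (u, v) \<in> parcs G \<Longrightarrow> u \<in> A \<Longrightarrow> v \<in> A \<Longrightarrow>
      \<exists>i\<in>pverts T. u \<in> bag i \<and> v \<in> bag i"
    and con: "\<And>v. v \<in> A \<Longrightarrow> connected (with_proj T \<restriction> {i \<in> pverts T. v \<in> bag i})"
    using dec by (auto simp: tree_decomposition_def)
  interpret T: finite_tree "pverts T" "parcs T" using T by (rule finite_tree_of_undirected_tree)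
  have "finite A" using A G.pair_finite_verts finite_subset by blast
  then have fin: "finite (bag i)" if "i \<in> pverts T" for i
    by (rule rev_finite_subset) (use bags that in auto)
  define nodes where "nodes v = {i \<in> pverts T. v \<in> bag i}" for v
  have linked: "linked (parcs T) (nodes v)" if "v \<in> A" for v
    using con[OF that] connected_induce_iff_linked[of T] T
    by (simp add: nodes_def undirected_tree_def)
  have sub: "nodes v \<subseteq> pverts T" for v by (auto simp: nodes_def)
  have meet: "nodes u \<inter> nodes v \<noteq> {}" if "(u, v) \<in> parcs G" "u \<in> A" "v \<in> A" for u v
    using edge_bag[OF that] by (auto simp: nodes_def)
  define avoiding where "avoiding D = {(x, y). (x, y) \<in> parcs G \<and> x \<in> A - D \<and> y \<in> A - D}" for D
  show ?thesis
  proof (cases "\<forall>i\<in>pverts T. avoiding (bag i) \<noteq> {}")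
    case True
    \<comment> \<open>The chosen edge depends on the bag only, so equal bags cannot point in opposite directions.\<close>
    define e where "e D = (SOME p. p \<in> avoiding D)" for D
    have e: "e (bag i) \<in> avoiding (bag i)" if "i \<in> pverts T" for i
      unfolding e_def using True that by (metis ex_in_conv someI_ex)
    \<comment> \<open>The nodes whose bags meet the chosen edge. They form a subtree because some
      bag contains both ends.\<close>
    define F where "F i = nodes (fst (e (bag i))) \<union> nodes (snd (e (bag i)))" for i
    have F: "linked (parcs T) (F i) \<and> F i \<subseteq> pverts T \<and> i \<notin> F i" if "i \<in> pverts T" for i
    proof -
      obtain x y where xy: "e (bag i) = (x, y)" by fastforce
      then have "(x, y) \<in> parcs G" "x \<in> A - bag i" "y \<in> A - bag i"
        using e[OF that] by (auto simp: avoiding_def)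
      moreover from this have "linked (parcs T) (F i)"
        unfolding F_def xy using linked meet by (auto intro!: linked_Un)
      ultimately show ?thesis using sub by (auto simp: F_def xy nodes_def)
    qed
    obtain i j where ij: "(i, j) \<in> parcs T" "F i \<subseteq> T.branch i j" "F j \<subseteq> T.branch j i"
      using T.edge_separating_missed_subtrees[of F, OF F] .
    have N: "i \<in> pverts T" "j \<in> pverts T" using ij(1) T.edges_in_nodes by auto
    have disj: "T.branch i j \<inter> T.branch j i = {}" using ij(1) by (rule T.branches_disjoint)
    let ?X = "bag i \<inter> bag j"
    have "bag i \<noteq> bag j"
    proof
      assume "bag i = bag j"
      then have "F i = F j" by (simp add: F_def)
      then have "F i = {}" using ij disj by blast
      then show False using F[OF N(1)] by (simp add: linked_def)
    qed
    \<comment> \<open>The width gives only \<open>k + 1\<close>; an intersection of that size would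
      equal both bags, which are distinct.\<close>
    have "card ?X \<le> k"
    proof (rule ccontr)
      assume "\<not> card ?X \<le> k"
      then have "card ?X \<ge> card (bag i)" "card ?X \<ge> card (bag j)" using width N by fastforce+
      then have "?X = bag i" "?X = bag j" using fin N by (intro card_seteq; simp)+
      with \<open>bag i \<noteq> bag j\<close> show False by simp
    qed
    obtain x y where xy: "e (bag i) = (x, y)" by fastforce
    obtain x' y' where xy': "e (bag j) = (x', y')" by fastforce
    have E: "(x, y) \<in> parcs G" "x \<in> A" "y \<in> A" "(x', y') \<in> parcs G" "x' \<in> A" "y' \<in> A"
      using e[OF N(1)] e[OF N(2)] by (auto simp: avoiding_def xy xy')
    \<comment> \<open>The subtree of a vertex adjacent to both edges has nodes in both branches, so
      it contains \<open>i\<close> and \<open>j\<close>.\<close>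
    have "w \<in> ?X" if w: "w \<in> A" and "(x, w) \<in> parcs G \<or> (y, w) \<in> parcs G"
      "(x', w) \<in> parcs G \<or> (y', w) \<in> parcs G" for w
    proof -
      have "nodes w \<inter> F i \<noteq> {}" "nodes w \<inter> F j \<noteq> {}"
        using that meet[of _ w] E by (auto simp: F_def xy xy')
      then obtain p q where "p \<in> nodes w" "p \<in> T.branch i j" "q \<in> nodes w" "q \<in> T.branch j i"
        using ij by blast
      then have "i \<in> nodes w \<and> j \<in> nodes w"
        using T.linked_across_edge[OF linked[OF w] ij(1)] disj by blast
      then show ?thesis by (simp add: nodes_def)
    qed
    then have "\<forall>w\<in>A - ?X. (x, w) \<notin> parcs G \<and> (y, w) \<notin> parcs G \<or>
        (x', w) \<notin> parcs G \<and> (y', w) \<notin> parcs G" by blast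
    moreover have "?X \<subseteq> A" using bags N by blast
    ultimately show ?thesis using E \<open>card ?X \<le> k\<close> by blast
  next
    case False
    then obtain i where i: "i \<in> pverts T" "avoiding (bag i) = {}" by blast
    \<comment> \<open>The subtrees of \<open>v\<close> and of its neighbours in the bag meet
      pairwise, so by Helly some bag contains them all; \<open>v\<close> itself takes up one of its
      \<open>k + 1\<close> places.\<close>
    have "card {b \<in> bag i. (v, b) \<in> parcs G} \<le> k" if v: "v \<in> A - bag i" for v
    proof -
      let ?K = "{b \<in> bag i. (v, b) \<in> parcs G}"
      have K: "?K \<subseteq> A" using bags i(1) by blast
      have pairwise: "nodes a \<inter> nodes b \<noteq> {}" if ab: "a \<in> insert v ?K" "b \<in> insert v ?K" for a b
      proof -
        consider "a = b" | "a = v" "b \<in> ?K" | "b = v" "a \<in> ?K" | "a \<in> ?K" "b \<in> ?K"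
          using ab by blast
        then show ?thesis
        proof cases
          case 1
          then show ?thesis using linked[of a] ab K v by (auto simp: linked_def)
        next
          case 2
          then show ?thesis using meet[of v b] K v by blast
        next
          case 3
          then show ?thesis using meet[of v a] K v by blast
        next
          case 4
          then show ?thesis using i(1) by (auto simp: nodes_def)
        qed
      qed
      have K_linked: "linked (parcs T) D \<and> D \<subseteq> pverts T" if "D \<in> nodes ` insert v ?K" for D
        using that linked K v sub by blast
      have K_meet: "D \<inter> D' \<noteq> {}" if "D \<in> nodes ` insert v ?K" "D' \<in> nodes ` insert v ?K" for D D'
        using that by (elim imageE) (simp only: pairwise not_False_eq_True)
      obtain p where p: "p \<in> pverts T" "\<forall>D\<in>nodes ` insert v ?K. p \<in> D"
        using T.subtrees_Helly[of "nodes ` insert v ?K", OF K_linked K_meet] by blast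
      have "insert v ?K \<subseteq> bag p" using p(2) by (fastforce simp: nodes_def)
      then have "card (insert v ?K) \<le> k + 1"
        using card_mono[OF fin[OF p(1)]] width[OF p(1)] le_trans by blast
      moreover have "finite ?K" "v \<notin> ?K" using fin[OF i(1)] v by auto
      ultimately show ?thesis by simp
    qed
    moreover have "bag i \<subseteq> A" using bags i(1) by blast
    ultimately have "independent_beyond G k (bag i) A"
      using i width by (auto simp: independent_beyond_def avoiding_def)
    then show ?thesis by blast
  qed
qed

text \<open>Since the two edges do not cover \<open>S\<close> even with \<open>X\<close> empty, some
  \<open>w\<close> is adjacent to an end of each. Two steps lead from \<open>u\<close> to
  \<open>w\<close> and two from \<open>w\<close> to \<open>x\<close>, hence the radius 4.\<close>

lemma edge_in_ball:
  assumes G: "pair_graph G" and S: "S \<subseteq> pverts G"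
    and uncov: "\<not> two_edge_covered G t S"
    and uv: "(u, v) \<in> parcs G" "u \<in> S" "v \<in> S"
    and xy: "(x, y) \<in> parcs G" "x \<in> S" "y \<in> S"
    and r: "r \<ge> 4"
  shows "x \<in> nbhd (with_proj G \<restriction> S) r u"
proof -
  interpret G: pair_graph G by fact
  let ?H = "with_proj G \<restriction> S"
  interpret H: wf_digraph ?H by (rule G.wellformed_induce_subgraph)
  have "\<not> S - {} - {u, v, x, y} \<subseteq> common_nonneighbours G u v \<union> common_nonneighbours G x y"
    using uncov uv xy unfolding two_edge_covered_def
    by (metis (no_types, lifting) card.empty empty_subsetI insert_subset zero_le)
  then obtain w where w: "w \<in> S" "(u, w) \<in> parcs G \<or> (v, w) \<in> parcs G"
      "(x, w) \<in> parcs G \<or> (y, w) \<in> parcs G"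
    using S by (auto simp: common_nonneighbours_def)
  obtain p where p: "H.awalk u p w" "length p \<le> 2"
  proof (cases "(u, w) \<in> parcs G")
    case True
    then show ?thesis using that[of "[(u, w)]"] uv w by (simp add: H.awalk_simps)
  next
    case False
    then show ?thesis using that[of "[(u, v), (v, w)]"] uv w by (simp add: H.awalk_simps)
  qed
  have yx: "(y, x) \<in> parcs G" using xy(1) by (rule G.arcs_symmetric)
  obtain q where q: "H.awalk w q x" "length q \<le> 2"
  proof (cases "(x, w) \<in> parcs G")
    case True
    then have "(w, x) \<in> parcs G" by (rule G.arcs_symmetric)
    then show ?thesis using that[of "[(w, x)]"] xy w by (simp add: H.awalk_simps)
  next
    case False
    then have "(w, y) \<in> parcs G" using w G.arcs_symmetric by blast
    then show ?thesis using that[of "[(w, y), (y, x)]"] xy yx w by (simp add: H.awalk_simps)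
  qed
  have "H.awalk u (p @ q) x" using p(1) q(1) by (rule H.awalk_appendI)
  then show ?thesis using p q r H.wf_digraph by (intro in_nbhdI[of _ _ "p @ q"]) auto
qed

text \<open>If \<open>S\<close> is not covered and has an edge, the ball \<open>A\<close> contains
  all edges of the induced subgraph. Vertices of \<open>S - A\<close> are isolated there, so both
  outcomes for \<open>A\<close> carry over to \<open>S\<close>.\<close>

lemma ltw_class_dichotomy:
  assumes G: "pair_graph G" and S: "S \<subseteq> pverts G"
    and cl: "with_proj G \<restriction> S \<in> ltw_class f"
    and r: "r \<ge> 4" "f r \<le> t"
  shows "two_edge_covered G t S \<or> (\<exists>B. independent_beyond G (f r) B S)"
proof (cases "two_edge_covered G t S")
  case uncov: False
  interpret G: pair_graph G by fact
  let ?H = "with_proj G \<restriction> S"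
  have "\<exists>B. independent_beyond G (f r) B S"
  proof (cases "\<exists>u\<in>S. \<exists>v\<in>S. (u, v) \<in> parcs G")
    case False
    then have "independent_beyond G (f r) {} S" by (auto simp: independent_beyond_def)
    then show ?thesis by blast
  next
    case True
    then obtain u v where uv: "(u, v) \<in> parcs G" "u \<in> S" "v \<in> S" by blast
    define A where "A = nbhd ?H r u"
    have AS: "A \<subseteq> S" by (auto simp: A_def nbhd_def)
    have ends: "x \<in> A \<and> y \<in> A" if "(x, y) \<in> parcs G" "x \<in> S" "y \<in> S" for x y
      using edge_in_ball[OF G S uncov uv _ _ _ r(1)] that G.arcs_symmetric[OF that(1)]
      unfolding A_def by blast
    have tw: "treewidth (with_proj G \<restriction> A) \<le> f r"
      using treewidth_ball_le[OF cl, of u r] uv induce_induce[OF AS, of "with_proj G"]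
      by (simp add: A_def)
    obtain T :: "nat pair_pre_digraph" and bag
      where dec: "tree_decomposition (with_proj G \<restriction> A) T bag"
        and "\<And>i. i \<in> pverts T \<Longrightarrow> card (bag i) \<le> treewidth (with_proj G \<restriction> A) + 1"
      using treewidth_attained[OF G.wellformed_induce_subgraph] by blast
    with tw have width: "card (bag i) \<le> f r + 1" if "i \<in> pverts T" for i
      using that by fastforce
    from bounded_bags_dichotomy[OF G _ dec width] AS S consider
      (cov) X x y x' y' where "X \<subseteq> A" "card X \<le> f r" "(x, y) \<in> parcs G" "(x', y') \<in> parcs G"
        "{x, y, x', y'} \<subseteq> A"
        "\<forall>w\<in>A - X. (x, w) \<notin> parcs G \<and> (y, w) \<notin> parcs G \<or>
          (x', w) \<notin> parcs G \<and> (y', w) \<notin> parcs G"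
      | (bag) B where "independent_beyond G (f r) B A" by blast
    then show ?thesis
    proof cases
      case cov
      have "w \<in> common_nonneighbours G x y \<union> common_nonneighbours G x' y'"
        if w: "w \<in> S - X - {x, y, x', y'}" for w
      proof (cases "w \<in> A")
        case True
        then have "(x, w) \<notin> parcs G \<and> (y, w) \<notin> parcs G \<or>
          (x', w) \<notin> parcs G \<and> (y', w) \<notin> parcs G" using cov(6) w by blast
        then show ?thesis using w S by (auto simp: common_nonneighbours_def)
      next
        case False
        have "(x, w) \<notin> parcs G" "(y, w) \<notin> parcs G"
          using False ends[of _ w] w cov(5) AS by blast+
        then show ?thesis using w S by (auto simp: common_nonneighbours_def)
      qed
      then have "S - X - {x, y, x', y'} \<subseteq>
          common_nonneighbours G x y \<union> common_nonneighbours G x' y'" by blast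
      moreover have "X \<subseteq> S" "{x, y, x', y'} \<subseteq> S" "card X \<le> t" using cov AS r(2) by auto
      ultimately have "two_edge_covered G t S"
        unfolding two_edge_covered_def using cov(3,4) by blast
      with uncov show ?thesis by blast
    next
      case bag
      have "card {b \<in> B. (v, b) \<in> parcs G} \<le> f r" if "v \<in> S - B" for v
      proof (cases "v \<in> A")
        case True
        then show ?thesis using bag that by (auto simp: independent_beyond_def)
      next
        case False
        then have "{b \<in> B. (v, b) \<in> parcs G} = {}"
          using ends[of v] that bag AS by (auto simp: independent_beyond_def)
        then show ?thesis by (metis card.empty zero_le)
      qed
      moreover have "(x, y) \<notin> parcs G" if "x \<in> S - B" "y \<in> S - B" for x y
        using that ends[of x y] bag by (auto simp: independent_beyond_def)
      ultimately have "independent_beyond G (f r) B S"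
        using bag AS by (auto simp: independent_beyond_def)
      then show ?thesis by blast
    qed
  qed
  then show ?thesis by blast
qed blast

section \<open>Counting\<close>

lemma card_UN_bounded:
  assumes "finite I" "\<And>x. x \<in> I \<Longrightarrow> card (A x) \<le> b"
  shows "card (\<Union>x\<in>I. A x) \<le> card I * b"
proof -
  have "card (\<Union>x\<in>I. A x) \<le> (\<Sum>x\<in>I. card (A x))" using assms(1) by (rule card_UN_le)
  also have "\<dots> \<le> card I * b" using assms(2) by (metis of_nat_id sum_bounded_above)
  finally show ?thesis .
qed

text \<open>A nonempty set of size at most \<open>t\<close> is the set of a list of length exactly
  \<open>t\<close>, padded by repeating an element. The factor 2 absorbs the empty set.\<close>

lemma card_small_subsets:
  assumes "finite V" "V \<noteq> {}"
  shows "card {X. X \<subseteq> V \<and> card X \<le> t} \<le> 2 * card V ^ t"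
proof -
  let ?L = "{xs. set xs \<subseteq> V \<and> length xs = t}"
  have L: "finite ?L" "card ?L = card V ^ t"
    using assms(1) by (simp_all add: finite_lists_length_eq card_lists_length_eq)
  have "X \<in> insert {} (set ` ?L)" if X: "X \<subseteq> V" "card X \<le> t" for X
  proof (cases "X = {}")
    case False
    then obtain x where x: "x \<in> X" by blast
    have "finite X" using X(1) assms(1) finite_subset by blast
    then obtain xs where xs: "set xs = X" "length xs = card X"
      by (metis distinct_card finite_distinct_list)
    let ?ys = "xs @ replicate (t - card X) x"
    have "set ?ys = X" "length ?ys = t" using xs x X(2) by auto
    then show ?thesis using X(1) by (metis (mono_tags, lifting) image_eqI insertCI mem_Collect_eq)
  qed simp
  then have "{X. X \<subseteq> V \<and> card X \<le> t} \<subseteq> insert {} (set ` ?L)" by blast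
  then have "card {X. X \<subseteq> V \<and> card X \<le> t} \<le> card (insert {} (set ` ?L))"
    using L(1) by (intro card_mono) auto
  also have "\<dots> \<le> Suc (card (set ` ?L))" by (rule card_insert_le_m1) auto
  also have "\<dots> \<le> Suc (card V ^ t)" using card_image_le[OF L(1), of set] L(2) by simp
  also have "\<dots> \<le> 2 * card V ^ t" using assms by (simp add: Suc_le_eq card_gt_0_iff)
  finally show ?thesis .
qed

section \<open>Maximal independent sets when edges have few common non-neighbours\<close>

definition maximal_independent_sets :: "'a pair_pre_digraph \<Rightarrow> 'a set \<Rightarrow> 'a set set" where
  "maximal_independent_sets G W = {I. I \<subseteq> W \<and> (\<forall>x\<in>I. \<forall>y\<in>I. (x, y) \<notin> parcs G) \<and>
     (\<forall>x\<in>W - I. \<exists>y\<in>I. (x, y) \<in> parcs G)}"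

locale co_closed_graph = pair_graph G for G :: "'a pair_pre_digraph" +
  fixes q :: nat
  assumes card_common_nonneighbours:
    "(u, v) \<in> parcs G \<Longrightarrow> card (common_nonneighbours G u v) \<le> q"
begin

lemma card_Pow_common_nonneighbours:
  assumes "(u, v) \<in> parcs G"
  shows "card (Pow (common_nonneighbours G u v)) \<le> 2 ^ q"
proof -
  have "finite (common_nonneighbours G u v)"
    using pair_finite_verts by (simp add: common_nonneighbours_def)
  then show ?thesis using card_common_nonneighbours[OF assms] by (simp add: card_Pow)
qed

lemma finite_maximal_independent_sets:
  assumes "finite W"
  shows "finite (maximal_independent_sets G W)"
  by (rule finite_subset[of _ "Pow W"]) (use assms in \<open>auto simp: maximal_independent_sets_def\<close>)

text \<open>If removing \<open>v\<close> destroys maximality, some \<open>x\<close> in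
  \<open>W\<close> had \<open>v\<close> as its only neighbour in \<open>I\<close>. Then the rest of
  \<open>I\<close> is adjacent to neither end of the edge between \<open>x\<close> and
  \<open>v\<close>.\<close>

lemma maximal_independent_sets_insert:
  assumes "v \<notin> W" "insert v W \<subseteq> pverts G" "I \<in> maximal_independent_sets G (insert v W)"
    "I - {v} \<notin> maximal_independent_sets G W"
  shows "\<exists>x\<in>W. (x, v) \<in> parcs G \<and> I \<in> insert v ` Pow (common_nonneighbours G x v)"
proof -
  have I: "I \<subseteq> insert v W" "\<forall>x\<in>I. \<forall>y\<in>I. (x, y) \<notin> parcs G"
      "\<forall>x\<in>insert v W - I. \<exists>y\<in>I. (x, y) \<in> parcs G"
    using assms(3) by (auto simp: maximal_independent_sets_def)
  then obtain x where x: "x \<in> W - I" "\<forall>y\<in>I - {v}. (x, y) \<notin> parcs G"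
    using assms(1,4) unfolding maximal_independent_sets_def by blast
  then have v: "v \<in> I" "(x, v) \<in> parcs G" using I(3) by blast+
  have "I - {v} \<subseteq> common_nonneighbours G x v"
    using I(1,2) x v(1) assms(2) by (auto simp: common_nonneighbours_def)
  then have "I \<in> insert v ` Pow (common_nonneighbours G x v)"
    using v(1) by (intro image_eqI[of _ _ "I - {v}"]) auto
  then show ?thesis using x(1) v(2) by blast
qed

text \<open>Vertices are added one at a time. A new vertex \<open>v\<close> creates at most
  \<open>2 ^ q\<close> further sets for each of its neighbours in \<open>W\<close>, and these
  increments sum to at most a square.\<close>

lemma card_maximal_independent_sets:
  assumes "W \<subseteq> pverts G"
  shows "card (maximal_independent_sets G W) \<le> 1 + (card W)\<^sup>2 * 2 ^ q"
proof -
  have "finite W" using assms pair_finite_verts finite_subset by blast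
  then show ?thesis using assms
  proof induct
    case empty
    have "maximal_independent_sets G {} = {{}}" by (auto simp: maximal_independent_sets_def)
    then show ?case by simp
  next
    case (insert v W)
    let ?M = "maximal_independent_sets G"
    let ?old = "{I \<in> ?M (insert v W). I - {v} \<in> ?M W}"
    let ?N = "{x \<in> W. (x, v) \<in> parcs G}"
    let ?new = "\<Union>x\<in>?N. insert v ` Pow (common_nonneighbours G x v)"
    have sub: "?M (insert v W) \<subseteq> ?old \<union> ?new"
      using maximal_independent_sets_insert[OF insert(2,4)] by blast
    have fin: "finite (?M (insert v W))" "finite (?M W)"
      using finite_maximal_independent_sets insert(1) by auto
    \<comment> \<open>Sets with equal image differ at most in \<open>v\<close>. If only one
      contained \<open>v\<close>, maximality of the other would give \<open>v\<close> a neighbour in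
      it, against independence of the larger set.\<close>
    have "inj_on (\<lambda>I. I - {v}) ?old"
    proof (rule inj_onI)
      fix I J assume IJ: "I \<in> ?old" "J \<in> ?old" "I - {v} = J - {v}"
      have False if "v \<in> K" "v \<notin> L" "K - {v} = L - {v}" "K \<in> ?old" "L \<in> ?old" for K L
      proof -
        have "K = insert v L" using that by blast
        then show False using that(2,4,5) by (auto simp: maximal_independent_sets_def)
      qed
      from this[of I J] this[of J I] IJ show "I = J" by blast
    qed
    then have "card ?old \<le> card (?M W)"
      by (rule card_inj_on_le) (use fin in auto)
    then have old: "card ?old \<le> 1 + (card W)\<^sup>2 * 2 ^ q" using insert by simp
    have "card (insert v ` Pow (common_nonneighbours G x v)) \<le> 2 ^ q" if "x \<in> ?N" for x
    proof -
      have "finite (Pow (common_nonneighbours G x v))"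
        using pair_finite_verts by (simp add: common_nonneighbours_def)
      then show ?thesis
        using card_image_le card_Pow_common_nonneighbours[of x v] that le_trans by blast
    qed
    then have "card ?new \<le> card ?N * 2 ^ q"
      using insert(1) by (intro card_UN_bounded) auto
    also have "\<dots> \<le> card W * 2 ^ q" using insert(1) by (intro mult_le_mono1 card_mono) auto
    finally have new: "card ?new \<le> card W * 2 ^ q" .
    have "card (?M (insert v W)) \<le> card (?old \<union> ?new)"
      using sub fin(1) insert(1) pair_finite_verts
      by (intro card_mono) (auto simp: common_nonneighbours_def)
    also have "\<dots> \<le> card ?old + card ?new" by (rule card_Un_le)
    also have "\<dots> \<le> 1 + (card W)\<^sup>2 * 2 ^ q + card W * 2 ^ q" using old new by simp
    also have "\<dots> \<le> 1 + (card (insert v W))\<^sup>2 * 2 ^ q"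
      using insert(1,2) by (simp add: power2_eq_square algebra_simps)
    finally show ?case .
  qed
qed

text \<open>A covered set is the union of \<open>X\<close>, the four ends and one subset of each
  common non-neighbourhood. With \<open>n\<close> vertices this leaves at most
  \<open>2 * n ^ t\<close> choices of \<open>X\<close>, \<open>n ^ 2\<close> for each edge and
  \<open>2 ^ q\<close> for each subset.\<close>

lemma card_two_edge_covered:
  assumes "pverts G \<noteq> {}"
  shows "card {S. S \<subseteq> pverts G \<and> two_edge_covered G t S} \<le> 2 * card (pverts G) ^ (t + 4) * 4 ^ q"
proof -
  let ?V = "pverts G" and ?P = "\<lambda>(u, v). Pow (common_nonneighbours G u v)"
  let ?I = "{X. X \<subseteq> ?V \<and> card X \<le> t} \<times> parcs G \<times> parcs G"
  let ?A = "\<lambda>(X, e, e'). (\<lambda>(Y, Y'). X \<union> {fst e, snd e, fst e', snd e'} \<union> Y \<union> Y') ` (?P e \<times> ?P e')"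
  have finP: "finite (?P e)" for e
    using pair_finite_verts by (simp add: common_nonneighbours_def split: prod.split)
  have finI: "finite ?I" using pair_finite_verts pair_finite_arcs by auto
  have "S \<in> (\<Union>x\<in>?I. ?A x)" if S: "S \<subseteq> ?V" "two_edge_covered G t S" for S
  proof -
    obtain X u v u' v' where *: "X \<subseteq> S" "card X \<le> t" "(u, v) \<in> parcs G" "(u', v') \<in> parcs G"
        "{u, v, u', v'} \<subseteq> S"
        "S - X - {u, v, u', v'} \<subseteq> common_nonneighbours G u v \<union> common_nonneighbours G u' v'"
      using S(2) unfolding two_edge_covered_def by (elim exE conjE) (rule that)
    have "S = X \<union> {u, v, u', v'} \<union> (S \<inter> common_nonneighbours G u v) \<union>
        (S \<inter> common_nonneighbours G u' v')"
      using *(1,5,6) by auto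
    then have "S \<in> ?A (X, (u, v), (u', v'))"
      unfolding prod.case by (intro image_eqI[where x =
          "(S \<inter> common_nonneighbours G u v, S \<inter> common_nonneighbours G u' v')"]) simp_all
    moreover have "(X, (u, v), (u', v')) \<in> ?I" using * S(1) by auto
    ultimately show ?thesis by (rule UN_I[rotated])
  qed
  then have sub: "{S. S \<subseteq> ?V \<and> two_edge_covered G t S} \<subseteq> (\<Union>x\<in>?I. ?A x)" by blast
  have "card (?A x) \<le> 4 ^ q" if x: "x \<in> ?I" for x
  proof -
    obtain X u v u' v' where x': "x = (X, (u, v), (u', v'))" "(u, v) \<in> parcs G" "(u', v') \<in> parcs G"
      using x by auto
    have "card (?A x) \<le> card (?P (u, v) \<times> ?P (u', v'))"
      unfolding x' prod.case by (rule card_image_le) (use finP[of "(u, v)"] finP[of "(u', v')"] in simp)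
    also have "\<dots> \<le> 2 ^ q * 2 ^ q"
      using x'(2,3) card_Pow_common_nonneighbours by (auto simp: card_cartesian_product intro: mult_le_mono)
    finally show ?thesis by (simp flip: power_mult_distrib)
  qed
  then have "card (\<Union>x\<in>?I. ?A x) \<le> card ?I * 4 ^ q" using finI by (intro card_UN_bounded)
  moreover have "card ?I \<le> (2 * card ?V ^ t) * (card ?V ^ 2 * card ?V ^ 2)"
  proof -
    have "parcs G \<subseteq> ?V \<times> ?V" by (auto dest: in_arcsD1 in_arcsD2)
    then have "card (parcs G) \<le> card (?V \<times> ?V)" using pair_finite_verts by (intro card_mono) auto
    then have "card (parcs G) \<le> card ?V ^ 2" by (simp add: card_cartesian_product power2_eq_square)
    then show ?thesis unfolding card_cartesian_product
      using card_small_subsets[OF pair_finite_verts assms] by (intro mult_le_mono)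
  qed
  moreover have "card {S. S \<subseteq> ?V \<and> two_edge_covered G t S} \<le> card (\<Union>x\<in>?I. ?A x)"
    using sub finI finP by (intro card_mono) auto
  ultimately have "card {S. S \<subseteq> ?V \<and> two_edge_covered G t S} \<le>
      (2 * card ?V ^ t) * (card ?V ^ 2 * card ?V ^ 2) * 4 ^ q"
    by (meson le_trans mult_le_mono1)
  then show ?thesis by (simp add: power_add power4_eq_xxxx power2_eq_square mult.assoc)
qed

text \<open>A vertex with at most \<open>k\<close> neighbours in \<open>B\<close> and none in
  \<open>S - B\<close> could be added to \<open>S\<close> without destroying the shape, so the
  larger set would still lie in the class.\<close>

lemma maximal_set_beyond_bag:
  assumes S: "S \<in> maximal_sets_in_class G (ltw_class f)" and B: "independent_beyond G k B S"
    and f: "\<And>r. r \<ge> 1 \<Longrightarrow> k \<le> f r"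
  shows "S - B \<in> maximal_independent_sets G {v \<in> pverts G - B. card {b \<in> B. (v, b) \<in> parcs G} \<le> k}"
proof -
  have SV: "S \<subseteq> pverts G" and max: "\<And>S'. S \<subset> S' \<Longrightarrow> S' \<subseteq> pverts G \<Longrightarrow> with_proj G \<restriction> S' \<notin> ltw_class f"
    using S by (auto simp: maximal_sets_in_class_def)
  have B': "B \<subseteq> S" "card B \<le> k + 1" "\<forall>x\<in>S - B. \<forall>y\<in>S - B. (x, y) \<notin> parcs G"
      "\<forall>v\<in>S - B. card {b \<in> B. (v, b) \<in> parcs G} \<le> k"
    using B by (auto simp: independent_beyond_def)
  have finB: "finite B" by (rule finite_subset[OF _ pair_finite_verts]) (use B'(1) SV in auto)
  have "\<exists>y\<in>S - B. (x, y) \<in> parcs G"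
    if x: "x \<in> pverts G - B" "card {b \<in> B. (x, b) \<in> parcs G} \<le> k" "x \<notin> S - B" for x
  proof (rule ccontr)
    assume "\<not> ?thesis"
    then have none: "\<And>y. y \<in> S - B \<Longrightarrow> (x, y) \<notin> parcs G \<and> (y, x) \<notin> parcs G"
      using arcs_symmetric by blast
    have "(y, z) \<notin> parcs G" if "y \<in> insert x S - B" "z \<in> insert x S - B" for y z
      using that none B'(3) no_loops' by blast
    moreover have "card {b \<in> B. (v, b) \<in> parcs G} \<le> k" if "v \<in> insert x S - B" for v
      using that B'(4) x(2) by blast
    ultimately have "with_proj G \<restriction> insert x S \<in> ltw_class f"
      using SV x(1) finB B'(2) f by (intro induce_in_ltw_class[OF pair_graph, of _ B k]) auto
    moreover have "S \<subset> insert x S" "insert x S \<subseteq> pverts G" using x SV by auto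
    ultimately show False using max by blast
  qed
  then show ?thesis using B'(3,4) SV by (auto simp: maximal_independent_sets_def)
qed

text \<open>Covered sets contribute the constant 2. Any other maximal set is a bag \<open>B\<close>
  together with a maximal independent set beyond it; rounding \<open>1 + n ^ 2 * 2 ^ q\<close> up to
  \<open>2 * n ^ 3 * 4 ^ q\<close> yields the constant 4.\<close>

lemma card_maximal_sets_le:
  assumes V: "pverts G \<noteq> {}" and r: "r \<ge> 4" "f r \<le> t" "\<And>s. s \<ge> 1 \<Longrightarrow> f r \<le> f s"
  shows "card (maximal_sets_in_class G (ltw_class f)) \<le> 6 * card (pverts G) ^ (t + 4) * 4 ^ q"
proof -
  let ?V = "pverts G"
  let ?W = "\<lambda>B. {v \<in> ?V - B. card {b \<in> B. (v, b) \<in> parcs G} \<le> f r}"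
  let ?Q = "{B. B \<subseteq> ?V \<and> card B \<le> t + 1}"
  let ?A = "{S. S \<subseteq> ?V \<and> two_edge_covered G t S}"
  let ?C = "\<Union>B\<in>?Q. (\<union>) B ` maximal_independent_sets G (?W B)"
  have fin: "finite (maximal_independent_sets G (?W B))" for B
    using pair_finite_verts by (intro finite_maximal_independent_sets) auto
  have n: "card ?V \<ge> 1" using V pair_finite_verts by (simp add: Suc_le_eq card_gt_0_iff)
  have "S \<in> ?A \<union> ?C" if S: "S \<in> maximal_sets_in_class G (ltw_class f)" for S
  proof -
    have SV: "S \<subseteq> ?V" "with_proj G \<restriction> S \<in> ltw_class f"
      using S by (auto simp: maximal_sets_in_class_def)
    from ltw_class_dichotomy[OF pair_graph SV r(1,2)] show ?thesis
    proof
      assume "two_edge_covered G t S"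
      then show ?thesis using SV by blast
    next
      assume "\<exists>B. independent_beyond G (f r) B S"
      then obtain B where B: "independent_beyond G (f r) B S" by blast
      have "S - B \<in> maximal_independent_sets G (?W B)"
        using maximal_set_beyond_bag[OF S B r(3)] .
      moreover have "S = B \<union> (S - B)" "B \<in> ?Q" using B SV r(2) by (auto simp: independent_beyond_def)
      ultimately show ?thesis by blast
    qed
  qed
  then have "maximal_sets_in_class G (ltw_class f) \<subseteq> ?A \<union> ?C" by blast
  then have "card (maximal_sets_in_class G (ltw_class f)) \<le> card (?A \<union> ?C)"
    using pair_finite_verts fin by (intro card_mono) auto
  also have "\<dots> \<le> card ?A + card ?C" by (rule card_Un_le)
  also have "\<dots> \<le> 2 * card ?V ^ (t + 4) * 4 ^ q + 4 * card ?V ^ (t + 4) * 4 ^ q"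
  proof (rule add_mono)
    show "card ?A \<le> 2 * card ?V ^ (t + 4) * 4 ^ q" using V by (rule card_two_edge_covered)
    have "card ((\<union>) B ` maximal_independent_sets G (?W B)) \<le> 2 * (card ?V ^ 3 * 4 ^ q)" for B
    proof -
      have "card ((\<union>) B ` maximal_independent_sets G (?W B)) \<le> card (maximal_independent_sets G (?W B))"
        using fin by (rule card_image_le)
      also have "\<dots> \<le> 1 + (card (?W B))\<^sup>2 * 2 ^ q" by (rule card_maximal_independent_sets) auto
      also have "\<dots> \<le> 1 + card ?V ^ 3 * 4 ^ q"
      proof -
        have "card (?W B) \<le> card ?V" using pair_finite_verts by (intro card_mono) auto
        then have "(card (?W B))\<^sup>2 \<le> card ?V ^ 2" by (rule power_mono) simp
        also have "\<dots> \<le> card ?V ^ 3" using n by (intro power_increasing) auto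
        finally have "(card (?W B))\<^sup>2 \<le> card ?V ^ 3" .
        moreover have "(2::nat) ^ q \<le> 4 ^ q" by (rule power_mono) auto
        ultimately show ?thesis by (simp add: mult_le_mono)
      qed
      also have "\<dots> \<le> 2 * (card ?V ^ 3 * 4 ^ q)" using n by (simp add: Suc_le_eq)
      finally show ?thesis .
    qed
    then have "card ?C \<le> card ?Q * (2 * (card ?V ^ 3 * 4 ^ q))"
      using pair_finite_verts by (intro card_UN_bounded) auto
    also have "\<dots> \<le> (2 * card ?V ^ (t + 1)) * (2 * (card ?V ^ 3 * 4 ^ q))"
      using card_small_subsets[OF pair_finite_verts V] by (rule mult_le_mono1)
    also have "\<dots> = 4 * (card ?V ^ (t + 1) * card ?V ^ 3) * 4 ^ q" by simp
    also have "card ?V ^ (t + 1) * card ?V ^ 3 = card ?V ^ (t + 4)"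
      by (simp add: power_add power3_eq_cube power4_eq_xxxx)
    finally show "card ?C \<le> 4 * card ?V ^ (t + 4) * 4 ^ q" .
  qed
  also have "\<dots> = 6 * card ?V ^ (t + 4) * 4 ^ q" by simp
  finally show ?thesis .
qed

end

section \<open>Complements of closed graphs and the final bound\<close>

lemma co_closed_graph_complement:
  assumes "pair_graph H" "c_closed c H" "pair_graph (complement_graph H)"
  shows "co_closed_graph (complement_graph H) (c - 1)"
proof -
  interpret H: pair_graph H by fact
  interpret G: pair_graph "complement_graph H" by fact
  show ?thesis
  proof
    fix u v assume "(u, v) \<in> parcs (complement_graph H)"
    then have uv: "u \<in> pverts H" "v \<in> pverts H" "u \<noteq> v" "(u, v) \<notin> parcs H"
      by (auto simp: complement_graph_def)
    have "common_nonneighbours (complement_graph H) u v \<subseteq>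
        {w \<in> pverts H. (u, w) \<in> parcs H \<and> (v, w) \<in> parcs H}"
      using uv by (auto simp: common_nonneighbours_def complement_graph_def)
    then have "card (common_nonneighbours (complement_graph H) u v) \<le>
        card {w \<in> pverts H. (u, w) \<in> parcs H \<and> (v, w) \<in> parcs H}"
      using H.pair_finite_verts by (intro card_mono) auto
    also have "\<dots> \<le> c - 1" using assms(2) uv by (auto simp: c_closed_def)
    finally show "card (common_nonneighbours (complement_graph H) u v) \<le> c - 1" .
  qed
qed

theorem theorem18:
  shows "\<exists>K :: real. \<forall>(t :: nat) (f :: nat \<Rightarrow> nat) (c :: nat) (n :: nat)
           (G :: 'a pair_pre_digraph) (H :: 'a pair_pre_digraph).
     t \<ge> 1 \<longrightarrow> f 1 = t \<longrightarrow> f 2 = t \<longrightarrow> f 3 = t \<longrightarrow> f 4 = t \<longrightarrow> f 5 = t \<longrightarrow>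
     c \<ge> 1 \<longrightarrow> n \<ge> 1 \<longrightarrow>
     pair_graph G \<longrightarrow> card (pverts G) = n \<longrightarrow>
     pair_graph H \<longrightarrow> c_closed c H \<longrightarrow> G = complement_graph H \<longrightarrow>
     real (card (maximal_sets_in_class G (ltw_class f))) \<le> K * (real n ^ (t + 4) * 4 ^ (c - 1))"
proof (intro exI[of _ 6] allI impI)
  fix t c n :: nat and f :: "nat \<Rightarrow> nat" and G H :: "'a pair_pre_digraph"
  assume f: "f 1 = t" "f 2 = t" "f 3 = t" "f 4 = t" "f 5 = t" and n: "n \<ge> 1"
    and G: "pair_graph G" "card (pverts G) = n"
    and H: "pair_graph H" "c_closed c H" "G = complement_graph H"
  interpret co_closed_graph G "c - 1"
    using co_closed_graph_complement H G(1) by blast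
  obtain r0 where r0: "r0 \<ge> 1" "\<And>s. s \<ge> 1 \<Longrightarrow> f r0 \<le> f s"
    using ex_has_least_nat[of "\<lambda>r. r \<ge> 1" 1 f] by auto
  \<comment> \<open>The ball argument needs radius at least 4. A minimiser below 4 has value
    \<open>t\<close>, which is also the value at 4, so raising it to 4 keeps the minimum.\<close>
  define r where "r = max 4 r0"
  have "r0 \<in> {1, 2, 3, 4} \<or> r0 > 4" using r0(1) by auto
  then have "f r = f r0" using f by (auto simp: r_def max_def)
  then have "\<And>s. s \<ge> 1 \<Longrightarrow> f r \<le> f s" "f r \<le> t" using r0(2) f(1) r0(2)[of 1] by auto
  moreover have "pverts G \<noteq> {}" using G(2) n by auto
  ultimately have "card (maximal_sets_in_class G (ltw_class f)) \<le> 6 * n ^ (t + 4) * 4 ^ (c - 1)"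
    using card_maximal_sets_le[of r f t] G(2) by (simp add: r_def)
  then have "real (card (maximal_sets_in_class G (ltw_class f))) \<le>
      real (6 * n ^ (t + 4) * 4 ^ (c - 1))"
    by (rule of_nat_mono)
  then show "real (card (maximal_sets_in_class G (ltw_class f))) \<le>
      6 * (real n ^ (t + 4) * 4 ^ (c - 1))"
    by simp
qed

end
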